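(* Let $m$ be an arbitrary positive integer. Then the following identity of formal series in $q$ holds: $$\sum_{(k_1,\dots,k_{4m-1})\in\mathbb{Z}^{4m-1}} q^{3m\,\kappa(k_1,\dots,k_{4m-1})+\widetilde{\mathrm{lin}}(k_1,\dots,k_{4m-1})}=\frac{\varphi(q^{3m})^{4m}\,\varphi(q^{2})^{2}}{\varphi(q)^{2}\,\varphi(q^{3})},$$ where $$\widetilde{\mathrm{lin}}(k_1,\dots,k_{4m-1})=-3k_1-\cdots-3k_{m-1}+(3m-2)k_m-k_{m+1}-\cdots-k_{4m-2}+(3m-1)k_{4m-1},$$ that is, $\widetilde{\mathrm{lin}}(k_1,\dots,k_{4m-1})=-3\sum_{i=1}^{m-1}k_i+(3m-2)k_m-\sum_{i=m+1}^{4m-2}k_i+(3m-1)k_{4m-1}$.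
   Context: $\varphi(q)=\prod_{j\ge 1}(1-q^{j})$ denotes Euler's product function. For $l\ge 1$, $$\kappa(k_1,\dots,k_l)=k_1^2+k_2^2+\cdots+k_l^2-k_1k_2-k_2k_3-\cdots-k_{l-1}k_l,$$ used here with $l=4m-1$. *)

theory Defs
  imports
    "HOL-Analysis.Analysis"
    "HOL-Computational_Algebra.Computational_Algebra"
begin

text \<open>Formal series in \<open>q\<close> have rational coefficients here; the product is a limit in the
  \<open>q\<close>-adic metric on \<^typ>\<open>rat fps\<close>, and it exists whenever the argument has no constant
  term (lemma \<open>euler_phi_has_prod\<close>). Thus \<open>euler_phi (fps_X ^ r)\<close> is \<open>\<phi>(q\<^sup>r)\<close> for \<open>r \<ge> 1\<close>.\<close>

definition euler_phi :: "rat fps \<Rightarrow> rat fps" where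
  "euler_phi x = (\<Prod>j. 1 - x ^ Suc j)"

text \<open>A tuple \<open>(k\<^sub>1, \<dots>, k\<^sub>l)\<close> is a function on the index set \<open>{1..l}\<close>.\<close>

definition kappa :: "nat \<Rightarrow> (nat \<Rightarrow> int) \<Rightarrow> int" where
  "kappa l k = (\<Sum>i = 1..l. (k i)\<^sup>2) - (\<Sum>i = 1..<l. k i * k (i + 1))"

definition lin_tilde :: "nat \<Rightarrow> (nat \<Rightarrow> int) \<Rightarrow> int" where
  "lin_tilde m k =
     - 3 * (\<Sum>i = 1..m - 1. k i) + (3 * int m - 2) * k m
     - (\<Sum>i = m + 1..4 * m - 2. k i) + (3 * int m - 1) * k (4 * m - 1)"

lemma euler_phi_has_prod:
  assumes "fps_nth x 0 = 0"
  shows "(\<lambda>j. 1 - x ^ Suc j) has_prod euler_phi x"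
proof -
  let ?P = "\<lambda>n. \<Prod>j\<le>n. 1 - x ^ Suc j"
  have step_coeff: "fps_nth (?P (Suc n)) i = fps_nth (?P n) i" if "i \<le> n" for i n
  proof -
    have "fps_nth (?P n * x ^ Suc (Suc n)) i = 0"
    proof -
      have "fps_nth (x ^ Suc (Suc n)) (i - t) = 0" for t
        using startsby_zero_power_prefix[OF assms] that by (simp del: power_Suc)
      thus ?thesis
        by (simp add: fps_mult_nth del: power_Suc)
    qed
    moreover have "?P (Suc n) = ?P n - ?P n * x ^ Suc (Suc n)"
      by (simp add: algebra_simps)
    ultimately show ?thesis
      by simp
  qed
  have stable: "fps_nth (?P n) i = fps_nth (?P i) i" if "i \<le> n" for i n
    using that proof (induction n rule: dec_induct)
    case base
    show ?case ..
  next
    case (step n)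
    then show ?case
      using step_coeff[of i n] by simp
  qed
  define L where "L = Abs_fps (\<lambda>i. fps_nth (?P i) i)"
  have "?P \<longlonglongrightarrow> L"
  proof (rule tendsto_fpsI)
    fix i
    show "eventually (\<lambda>n. fps_nth (?P n) i = fps_nth L i) sequentially"
      using eventually_ge_at_top[of i] proof eventually_elim
        case (elim n)
        show ?case
          unfolding L_def fps_nth_Abs_fps by (rule stable[OF elim])
      qed
  qed
  moreover have "fps_nth L 0 = 1"
    using assms by (simp add: L_def)
  hence "L \<noteq> 0"
    by auto
  ultimately have *: "(\<lambda>j. 1 - x ^ Suc j) has_prod L"
    by (simp add: has_prod_def raw_has_prod_def)
  show ?thesis
    unfolding euler_phi_def has_prod_unique[OF *, symmetric] by (rule *)
qed

end

theory Submission
  imports Defs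
begin

text \<open>In the coordinates \<open>x\<^sub>j = k\<^sub>j - k\<^sub>j\<^sub>-\<^sub>1\<close> (with \<open>k\<^sub>0 = k\<^sub>4\<^sub>m = 0\<close>) the exponent becomes
  \<open>\<Sum>\<^sub>j 3m x\<^sub>j(x\<^sub>j - 1)/2 + d\<^sub>j x\<^sub>j\<close>, so by the Jacobi triple product the sum is the constant term in
  \<open>y\<close> of a product of \<open>4m\<close> theta functions in base \<open>q\<^sup>3\<^sup>m\<close>. The shifts \<open>d\<^sub>j\<close> run once through all
  residues modulo \<open>3m\<close> and once through those that are \<open>2\<close> modulo 3, so this product collapses to
  two theta functions, in base \<open>q\<close> and in base \<open>q\<^sup>3\<close>, whose constant term is Gauss's series
  \<open>\<Sum>\<^sub>k q\<^bsup>2k\<^sup>2-k\<^esup> = \<phi>(q\<^sup>2)\<^sup>2/\<phi>(q)\<close>. To stay within formal series, the triple product is replaced by the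
  finite \<open>q\<close>-binomial theorem, where the constant term is the middle coefficient of a polynomial in
  \<open>y\<close>, and the number of factors then tends to infinity.\<close>

subsection \<open>Limits of formal power series\<close>

text \<open>Coefficient \<open>n\<close> of a product involves only the coefficients up to
  \<open>n\<close> of the factors. These are finitely many, so they are eventually all equal to
  those of the limits.\<close>

lemma tendsto_mult_fps:
  fixes f g :: "'b \<Rightarrow> 'a :: comm_ring_1 fps"
  assumes "(f \<longlongrightarrow> a) F" "(g \<longlongrightarrow> b) F"
  shows "((\<lambda>x. f x * g x) \<longlongrightarrow> a * b) F"
proof (rule tendsto_fpsI)
  fix n
  have "eventually (\<lambda>x. \<forall>i\<in>{..n}. fps_nth (f x) i = fps_nth a i) F"
    using assms(1) by (subst eventually_ball_finite_distrib) (auto simp: tendsto_fps_iff)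
  moreover have "eventually (\<lambda>x. \<forall>i\<in>{..n}. fps_nth (g x) i = fps_nth b i) F"
    using assms(2) by (subst eventually_ball_finite_distrib) (auto simp: tendsto_fps_iff)
  ultimately show "eventually (\<lambda>x. fps_nth (f x * g x) n = fps_nth (a * b) n) F"
    by eventually_elim (auto simp: fps_mult_nth intro!: sum.cong)
qed

lemma tendsto_prod_finite_fps:
  fixes f :: "'c \<Rightarrow> 'b \<Rightarrow> 'a :: comm_ring_1 fps"
  assumes "\<And>j. j \<in> J \<Longrightarrow> (f j \<longlongrightarrow> a j) F"
  shows "((\<lambda>x. \<Prod>j\<in>J. f j x) \<longlongrightarrow> (\<Prod>j\<in>J. a j)) F"
  using assms by (induction J rule: infinite_finite_induct) (auto intro: tendsto_mult_fps)

text \<open>The sum of q^(e x) over \<open>A\<close>, given by its coefficients. As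
  \<open>card\<close> is 0 on infinite sets, it has this meaning only when the fibres of
  \<open>e\<close> on \<open>A\<close> are finite, and the lemmas on it assume finite sublevel
  sets.\<close>

definition theta_fps :: "('a \<Rightarrow> nat) \<Rightarrow> 'a set \<Rightarrow> rat fps" where
  "theta_fps e A = Abs_fps (\<lambda>n. of_nat (card {x \<in> A. e x = n}))"

lemma has_sum_theta_fps:
  assumes "\<And>n. finite {x \<in> A. e x \<le> n}"
  shows "((\<lambda>x. fps_X ^ e x) has_sum theta_fps e A) A"
proof -
  have eq: "{x \<in> A. fps_nth (fps_X ^ e x :: rat fps) n \<noteq> 0} = {x \<in> A. e x = n}" for n
    by auto
  show ?thesis
  proof (rule has_sum_fpsI, unfold eq)
    fix n
    show "finite {x \<in> A. e x = n}"
      by (rule finite_subset[OF _ assms[of n]]) auto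
    show "fps_nth (theta_fps e A) n = (\<Sum>x | x \<in> A \<and> e x = n. fps_nth (fps_X ^ e x) n)"
      by (simp add: theta_fps_def)
  qed
qed

text \<open>A Tannery theorem for formal series, which carries the finite identities to the limit.
  Coefficient \<open>n\<close> sees only the finite set \<open>B\<close> of points with
  \<open>e x \<le> n\<close>; eventually \<open>S M\<close> contains all of \<open>B\<close>, and
  the relevant coefficients of the weights there have settled.\<close>

lemma tendsto_theta_fps:
  fixes W :: "nat \<Rightarrow> 'a \<Rightarrow> rat fps"
  assumes fin: "\<And>n. finite {x \<in> A. e x \<le> n}"
    and S: "\<And>M. finite (S M)" "\<And>M. S M \<subseteq> A"
      "\<And>x. x \<in> A \<Longrightarrow> eventually (\<lambda>M. x \<in> S M) sequentially"
    and W: "\<And>x. x \<in> A \<Longrightarrow> (\<lambda>M. W M x) \<longlonglongrightarrow> w"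
  shows "(\<lambda>M. \<Sum>x\<in>S M. fps_X ^ e x * W M x) \<longlonglongrightarrow> theta_fps e A * w"
proof (rule tendsto_fpsI)
  fix n
  define B where "B = {x \<in> A. e x \<le> n}"
  have B: "finite B" "B \<subseteq> A"
    using fin by (auto simp: B_def)
  have theta: "fps_nth (theta_fps e A) i = fps_nth (\<Sum>x\<in>B. fps_X ^ e x) i" if "i \<le> n" for i
  proof -
    have "fps_nth (\<Sum>x\<in>B. fps_X ^ e x :: rat fps) i = (\<Sum>x\<in>B. if e x = i then 1 else 0)"
      by (simp add: fps_sum_nth eq_commute)
    also have "\<dots> = of_nat (card (B \<inter> {x. e x = i}))"
      using B by (simp add: sum.If_cases)
    also have "B \<inter> {x. e x = i} = {x \<in> A. e x = i}"
      using that by (auto simp: B_def)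
    finally show ?thesis
      by (simp add: theta_fps_def)
  qed
  have "fps_nth (theta_fps e A * w) n = fps_nth ((\<Sum>x\<in>B. fps_X ^ e x) * w) n"
    unfolding fps_mult_nth by (intro sum.cong) (auto simp: theta)
  also have "\<dots> = (\<Sum>x\<in>B. fps_nth w (n - e x))"
    by (auto simp: sum_distrib_right fps_sum_nth fps_X_power_mult_nth B_def intro!: sum.cong)
  finally have lim: "fps_nth (theta_fps e A * w) n = (\<Sum>x\<in>B. fps_nth w (n - e x))" .
  have "eventually (\<lambda>M. \<forall>x\<in>B. x \<in> S M \<and> fps_nth (W M x) (n - e x) = fps_nth w (n - e x)) sequentially"
    using B W S(3) by (subst eventually_ball_finite_distrib)
      (auto simp: eventually_conj_iff tendsto_fps_iff)
  thus "eventually (\<lambda>M. fps_nth (\<Sum>x\<in>S M. fps_X ^ e x * W M x) n =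
          fps_nth (theta_fps e A * w) n) sequentially"
  proof eventually_elim
    case (elim M)
    have "fps_nth (\<Sum>x\<in>S M. fps_X ^ e x * W M x) n =
        (\<Sum>x\<in>S M. if n < e x then 0 else fps_nth (W M x) (n - e x))"
      by (simp add: fps_sum_nth fps_X_power_mult_nth)
    also have "\<dots> = (\<Sum>x\<in>B. fps_nth w (n - e x))"
      using elim S by (intro sum.mono_neutral_cong_right) (auto simp: B_def)
    finally show ?case
      using lim by simp
  qed
qed

text \<open>The embedding into Laurent series is an isometry for the q-adic metrics.\<close>

lemma tendsto_fps_to_fls:
  fixes f :: "'b \<Rightarrow> 'a :: group_add fps"
  assumes "(f \<longlongrightarrow> a) F"
  shows "((\<lambda>x. fps_to_fls (f x)) \<longlongrightarrow> fps_to_fls a) F"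
proof -
  have "dist (fps_to_fls b) (fps_to_fls c) = dist b c" for b c :: "'a fps"
    by (auto simp: dist_fls_def dist_fps_def fls_subdegree_fls_to_fps
        simp del: fps_to_fls_minus simp flip: fps_to_fls_minus)
  thus ?thesis
    using assms unfolding tendsto_dist_iff[of _ a] tendsto_dist_iff[of _ "fps_to_fls a"] by simp
qed

lemma has_sum_fps_to_fls:
  fixes f :: "'b \<Rightarrow> 'a :: ab_group_add fps"
  assumes "(f has_sum s) A"
  shows "((\<lambda>x. fps_to_fls (f x)) has_sum fps_to_fls s) A"
proof -
  have "sum (\<lambda>x. fps_to_fls (f x)) X = fps_to_fls (sum f X)" for X
    by (induction X rule: infinite_finite_induct) auto
  thus ?thesis
    unfolding has_sum_def using tendsto_fps_to_fls[OF assms[unfolded has_sum_def]] by presburger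
qed

subsection \<open>Gaussian binomial coefficients\<close>

text \<open>The q-Pascal recurrence serves as definition because it needs no division and so works
  in every commutative ring.\<close>

fun qbinomial :: "'a :: comm_ring_1 \<Rightarrow> nat \<Rightarrow> nat \<Rightarrow> 'a" where
  "qbinomial q L 0 = 1"
| "qbinomial q 0 (Suc i) = 0"
| "qbinomial q (Suc L) (Suc i) = qbinomial q L (Suc i) + q ^ (L - i) * qbinomial q L i"

lemma qbinomial_eq_0: "L < i \<Longrightarrow> qbinomial q L i = 0"
  by (induction q L i rule: qbinomial.induct) auto

text \<open>Splitting off the factor \<open>n = L\<close> gives a two-term recurrence in
  \<open>i\<close>, which is q-Pascal. The homogeneous form in \<open>a\<close> and \<open>b\<close>
  lets a power of q sit in the constant term, where an inhomogeneous form would need a negative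
  exponent.\<close>

theorem qbinomial_theorem:
  fixes a b q :: "'a :: comm_ring_1"
  shows "coeff (\<Prod>n<L. [:a, b * q ^ n:]) i =
    qbinomial q L i * q ^ (i choose 2) * a ^ (L - i) * b ^ i"
proof (induction L arbitrary: i)
  case 0
  show ?case
    by (cases i) (auto simp: numeral_2_eq_2)
next
  case (Suc L)
  show ?case
  proof (cases i)
    case 0
    thus ?thesis
      using Suc.IH[of 0] by (simp add: coeff_mult numeral_2_eq_2)
  next
    case (Suc i')
    \<comment> \<open>For \<open>i > L\<close> the truncated subtraction breaks the exponent law,
      but then the Gaussian binomial is 0.\<close>
    have 1: "qbinomial q L i * (a * a ^ (L - i)) = qbinomial q L i * a ^ (L - i')"
    proof (cases "i \<le> L")
      case True
      hence "L - i' = Suc (L - i)"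
        using Suc by simp
      thus ?thesis
        by simp
    qed (auto simp: qbinomial_eq_0)
    have 2: "qbinomial q L i' * q ^ L = qbinomial q L i' * (q ^ (L - i') * q ^ i')"
      by (cases "i' \<le> L") (auto simp: qbinomial_eq_0 simp flip: power_add)
    have choose: "q ^ (i choose 2) = q ^ i' * q ^ (i' choose 2)"
      using Suc by (simp add: power_add numeral_2_eq_2)
    have "coeff (\<Prod>n<Suc L. [:a, b * q ^ n:]) i =
        a * coeff (\<Prod>n<L. [:a, b * q ^ n:]) i + b * q ^ L * coeff (\<Prod>n<L. [:a, b * q ^ n:]) i'"
      using Suc by (simp add: mult.commute[of _ "[:a, b * q ^ L:]"])
    also have "\<dots> = (qbinomial q L i * (a * a ^ (L - i))) * q ^ (i choose 2) * b ^ i +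
        (qbinomial q L i' * q ^ L) * q ^ (i' choose 2) * a ^ (L - i') * (b * b ^ i')"
      unfolding Suc.IH by (simp add: algebra_simps)
    also have "\<dots> = qbinomial q (Suc L) i * q ^ (i choose 2) * a ^ (Suc L - i) * b ^ i"
      unfolding 1 2 choose using Suc by (simp add: algebra_simps)
    finally show ?thesis .
  qed
qed

lemma degree_qbinomial_prod_le:
  fixes a b q :: "'a :: comm_ring_1"
  shows "degree (\<Prod>n<L. [:a, b * q ^ n:]) \<le> L"
  by (rule degree_le) (auto simp: qbinomial_theorem qbinomial_eq_0)

lemma sum_qbinomial_eq_prod:
  fixes a b q :: "'a :: comm_ring_1"
  shows "(\<Sum>i\<le>L. qbinomial q L i * q ^ (i choose 2) * a ^ (L - i) * b ^ i) = (\<Prod>n<L. a + b * q ^ n)"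
proof -
  let ?p = "\<Prod>n<L. [:a, b * q ^ n:]"
  from poly_as_sum_of_monoms'[OF degree_qbinomial_prod_le, of a b q L]
  have "poly ?p 1 = poly (\<Sum>i\<le>L. monom (coeff ?p i) i) 1"
    by (rule arg_cong[OF sym])
  also have "\<dots> = (\<Sum>i\<le>L. coeff ?p i)"
    by (simp add: poly_sum poly_monom)
  finally have "poly ?p 1 = (\<Sum>i\<le>L. coeff ?p i)" .
  thus ?thesis
    by (simp add: qbinomial_theorem poly_prod)
qed

section \<open>Closed form and limit of the Gaussian binomials\<close>

definition qpoch :: "'a :: comm_ring_1 \<Rightarrow> nat \<Rightarrow> 'a" where
  "qpoch q n = (\<Prod>j<n. 1 - q ^ Suc j)"

lemma qpoch_Suc: "qpoch q (Suc n) = qpoch q n * (1 - q ^ Suc n)"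
  by (simp add: qpoch_def)

lemma qpoch_0 [simp]: "qpoch q 0 = 1"
  by (simp add: qpoch_def)

lemma qbinomial_self [simp]: "qbinomial q L L = 1"
  by (induction L) (auto simp: qbinomial_eq_0)

text \<open>The induction step rests on 1 - q^(L+1) = (1 - q^(L-i)) + q^(L-i) (1 - q^(i+1)), whose
  two parts match the two terms of the recurrence.\<close>

lemma qbinomial_mult_qpoch:
  "i \<le> L \<Longrightarrow> qbinomial q L i * (qpoch q i * qpoch q (L - i)) = qpoch q L"
proof (induction q L i rule: qbinomial.induct)
  case (3 q L i)
  show ?case
  proof (cases "i = L")
    case False
    hence le: "Suc i \<le> L" "i \<le> L"
      using 3 by auto
    have s: "qpoch q (L - i) = qpoch q (L - Suc i) * (1 - q ^ (L - i))"
      using le qpoch_Suc[of q "L - Suc i"] by (simp add: Suc_diff_Suc del: power_Suc)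
    have "q ^ Suc L = q ^ (L - i) * q ^ Suc i"
      using le unfolding power_add[symmetric] by simp
    have "qbinomial q (Suc L) (Suc i) * (qpoch q (Suc i) * qpoch q (Suc L - Suc i)) =
       (qbinomial q L (Suc i) * (qpoch q (Suc i) * qpoch q (L - Suc i))) * (1 - q ^ (L - i)) +
       q ^ (L - i) * (1 - q ^ Suc i) * (qbinomial q L i * (qpoch q i * qpoch q (L - i)))"
      by (simp add: s qpoch_Suc algebra_simps del: power_Suc)
    also have "\<dots> = qpoch q L * (1 - q ^ (L - i) * q ^ Suc i)"
      using 3 le by (simp add: algebra_simps)
    also have "\<dots> = qpoch q (Suc L)"
      unfolding \<open>q ^ Suc L = _\<close>[symmetric] by (simp add: qpoch_Suc)
    finally show ?thesis .
  qed simp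
qed auto

lemma qpoch_tendsto_euler_phi:
  assumes "r \<ge> 1"
  shows "qpoch (fps_X ^ r) \<longlonglongrightarrow> euler_phi (fps_X ^ r)"
  unfolding qpoch_def using euler_phi_has_prod[of "fps_X ^ r"] assms
  by (intro has_prod_imp_tendsto') auto

lemma fps_nth_qpoch_0 [simp]:
  assumes "r \<ge> 1"
  shows "fps_nth (qpoch (fps_X ^ r :: 'a :: comm_ring_1 fps) n) 0 = 1"
  using assms by (induction n) (auto simp: qpoch_Suc fps_power_zeroth zero_power)

lemma fps_nth_euler_phi_0 [simp]:
  assumes "r \<ge> 1"
  shows "fps_nth (euler_phi (fps_X ^ r)) 0 = 1"
proof -
  have "eventually (\<lambda>n. fps_nth (qpoch (fps_X ^ r) n) 0 = fps_nth (euler_phi (fps_X ^ r)) 0) sequentially"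
    using qpoch_tendsto_euler_phi[OF assms] by (simp only: tendsto_fps_iff)
  thus ?thesis
    using assms by simp
qed

lemma euler_phi_nonzero [simp]: "r \<ge> 1 \<Longrightarrow> euler_phi (fps_X ^ r) \<noteq> 0"
  using fps_nth_euler_phi_0[of r] by (metis fps_zero_nth zero_neq_one)

text \<open>All three q-factorials of the closed form tend to \<phi>, so the quotient tends to
  \<phi>/(\<phi> \<phi>).\<close>

lemma qbinomial_tendsto:
  assumes r: "r \<ge> 1" and i: "filterlim i at_top sequentially"
    and Li: "filterlim (\<lambda>M. L M - i M) at_top sequentially"
  shows "(\<lambda>M. qbinomial (fps_X ^ r) (L M) (i M)) \<longlonglongrightarrow> inverse (euler_phi (fps_X ^ r))"
proof -
  let ?q = "fps_X ^ r :: rat fps"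
  let ?\<phi> = "euler_phi ?q"
  \<comment> \<open>Since subtraction truncates, a positive difference is what guarantees
    \<open>i M \<le> L M\<close>, the hypothesis of the closed form.\<close>
  have ev: "eventually (\<lambda>M. L M - i M \<ge> 1) sequentially"
    using Li by (simp only: filterlim_at_top)
  have L: "filterlim L at_top sequentially"
    by (rule filterlim_at_top_mono[OF Li]) auto
  note lim = filterlim_compose[OF qpoch_tendsto_euler_phi[OF r]]
  have "(\<lambda>M. qpoch ?q (L M) * inverse (qpoch ?q (i M) * qpoch ?q (L M - i M)))
          \<longlonglongrightarrow> ?\<phi> * inverse (?\<phi> * ?\<phi>)"
    by (intro tendsto_mult_fps tendsto_inverse_fps lim L Li i) (use r in auto)
  also have "?\<phi> * inverse (?\<phi> * ?\<phi>) = inverse ?\<phi>"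
    using r by (simp add: fps_inverse_mult mult.assoc[symmetric] inverse_mult_eq_1')
  finally show ?thesis
  proof (rule Lim_transform_eventually)
    show "eventually (\<lambda>M. qpoch ?q (L M) * inverse (qpoch ?q (i M) * qpoch ?q (L M - i M)) =
       qbinomial ?q (L M) (i M)) sequentially"
      using ev
    proof eventually_elim
      case (elim M)
      have "qpoch ?q (L M) = qbinomial ?q (L M) (i M) * (qpoch ?q (i M) * qpoch ?q (L M - i M))"
        using elim by (intro qbinomial_mult_qpoch[symmetric]) auto
      show ?case
        unfolding \<open>qpoch ?q (L M) = _\<close> mult.assoc[of "qbinomial ?q (L M) (i M)"]
        by (subst inverse_mult_eq_1') (use r in auto)
    qed
  qed
qed

lemma prod_residue_classes:
  fixes F :: "nat \<Rightarrow> 'a :: comm_monoid_mult"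
  shows "(\<Prod>j<a. \<Prod>n<N. F (j + a * n)) = (\<Prod>n<a * N. F n)"
proof -
  have "(\<Prod>j<a. \<Prod>n<N. F (j + a * n)) = (\<Prod>n<N. \<Prod>j<a. F (j + a * n))"
    by (rule prod.swap)
  also have "\<dots> = (\<Prod>n<N. prod F {n * a..<n * a + a})"
  proof (rule prod.cong[OF refl])
    fix n
    show "(\<Prod>j<a. F (j + a * n)) = prod F {n * a..<n * a + a}"
      by (rule prod.reindex_bij_witness[of _ "\<lambda>i. i - n * a" "\<lambda>j. j + n * a"])
        (auto simp: mult.commute)
  qed
  finally show ?thesis
    by (simp add: prod.nat_group mult.commute)
qed

lemma two_times_choose_two: "2 * int (n choose 2) = int n * (int n - 1)"
  by (induction n) (auto simp: numeral_2_eq_2 algebra_simps)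

subsection \<open>Gauss's theta series\<close>

text \<open>As k runs over the integers, k(2k-1) takes each triangular number exactly once.
  \<open>nat\<close> loses nothing, by the next lemma.\<close>

definition gauss_exp :: "int \<Rightarrow> nat" where
  "gauss_exp k = nat (2 * k ^ 2 - k)"

lemma abs_le_gauss_exp: "\<bar>k\<bar> \<le> 2 * k ^ 2 - k" for k :: int
proof -
  have "\<bar>k\<bar> * 1 \<le> \<bar>k\<bar> * \<bar>k\<bar>"
    by (cases "k = 0") (auto intro!: mult_left_mono simp del: abs_mult_self_eq)
  thus ?thesis
    by (auto simp: power2_eq_square abs_if split: if_splits)
qed

lemma int_gauss_exp [simp]: "int (gauss_exp k) = 2 * k ^ 2 - k"
  using abs_le_gauss_exp[of k] by (simp add: gauss_exp_def)

lemma finite_gauss_exp_le: "finite {k \<in> UNIV. gauss_exp k \<le> n}"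
proof (rule finite_subset)
  show "{k \<in> UNIV. gauss_exp k \<le> n} \<subseteq> {- int n..int n}"
  proof safe
    fix k assume "gauss_exp k \<le> n"
    hence "\<bar>k\<bar> \<le> int n"
      using abs_le_gauss_exp[of k] by (simp flip: int_gauss_exp)
    thus "k \<in> {- int n..int n}"
      by auto
  qed
qed auto

text \<open>A finite Jacobi triple product: the q-binomial theorem in base q^4 with a = q^(4M-1), b
  = 1, L = 2M and the index centred as i = M + k. Both sides acquire the factor q^c, which is
  cancelled at the end.\<close>

lemma gauss_sum_finite:
  assumes "M \<ge> 1"
  shows "(\<Sum>k\<in>{- int M..int M}. fps_X ^ gauss_exp k * qbinomial (fps_X ^ 4) (2 * M) (nat (int M + k))) =
    (\<Prod>n<2 * M. 1 + fps_X ^ (2 * n + 1) :: rat fps)"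
proof -
  let ?X = "fps_X :: rat fps"
  \<comment> \<open>The power of q pulled out of the product: 4n from each factor with n < M, and
    4M-1 from each of the other M factors. It is also the exponent of the central term k =
    0.\<close>
  define c where "c = (\<Sum>n<M. 4 * n) + M * (4 * M - 1)"
  have c: "int c = 6 * int M ^ 2 - 3 * int M"
  proof -
    have "int (\<Sum>n<L. 4 * n) = 2 * int L * (int L - 1)" for L
      by (induction L) (auto simp: algebra_simps)
    moreover have "int (4 * M - 1) = 4 * int M - 1"
      using assms by (simp add: of_nat_diff)
    ultimately show ?thesis
      unfolding c_def of_nat_add of_nat_mult[of M] by (simp add: algebra_simps power2_eq_square)
  qed
  have Xc: "?X ^ c = ?X ^ (\<Sum>n<M. 4 * n) * (?X ^ (4 * M - 1)) ^ M"
    by (simp only: c_def power_add power_mult mult.commute[of M])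
  have "(\<Sum>i\<le>2 * M. qbinomial (?X ^ 4) (2 * M) i * (?X ^ 4) ^ (i choose 2) *
      (?X ^ (4 * M - 1)) ^ (2 * M - i) * 1 ^ i) =
     (\<Sum>k\<in>{- int M..int M}. ?X ^ c * (?X ^ gauss_exp k * qbinomial (?X ^ 4) (2 * M) (nat (int M + k))))"
  proof (rule sum.reindex_bij_witness[of _ "\<lambda>k. nat (int M + k)" "\<lambda>i. int i - int M"])
    fix i assume "i \<in> {..2 * M}"
    hence i: "i \<le> 2 * M"
      by simp
    have "int (4 * (i choose 2) + (4 * M - 1) * (2 * M - i)) =
        2 * (2 * int (i choose 2)) + (4 * int M - 1) * (2 * int M - int i)"
      using i assms by (simp add: of_nat_diff)
    also have "\<dots> = int (c + gauss_exp (int i - int M))"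
      unfolding two_times_choose_two by (simp add: c algebra_simps power2_eq_square)
    finally have "4 * (i choose 2) + (4 * M - 1) * (2 * M - i) = c + gauss_exp (int i - int M)"
      by (simp only: of_nat_eq_iff)
    hence "(?X ^ 4) ^ (i choose 2) * (?X ^ (4 * M - 1)) ^ (2 * M - i) =
        ?X ^ c * ?X ^ gauss_exp (int i - int M)"
      unfolding power_mult[symmetric] power_add[symmetric] by simp
    thus "?X ^ c * (?X ^ gauss_exp (int i - int M) *
        qbinomial (?X ^ 4) (2 * M) (nat (int M + (int i - int M)))) =
      qbinomial (?X ^ 4) (2 * M) i * (?X ^ 4) ^ (i choose 2) *
        (?X ^ (4 * M - 1)) ^ (2 * M - i) * 1 ^ i"
      by (simp add: mult_ac)
  qed auto
  hence "?X ^ c * (\<Sum>k\<in>{- int M..int M}. ?X ^ gauss_exp k * qbinomial (?X ^ 4) (2 * M) (nat (int M + k))) =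
      (\<Prod>n<2 * M. ?X ^ (4 * M - 1) + 1 * (?X ^ 4) ^ n)"
    unfolding sum_qbinomial_eq_prod by (simp add: sum_distrib_left)
  also have "\<dots> = (\<Prod>n<M. ?X ^ (4 * M - 1) + ?X ^ (4 * n)) *
      (\<Prod>n<M. ?X ^ (4 * M - 1) + ?X ^ (4 * (M + n)))"
  proof -
    have "{..<2 * M} = {..<M} \<union> {M..<M + M}" "{..<M} \<inter> {M..<M + M} = {}"
      by auto
    moreover have "prod f {M..<M + M} = (\<Prod>n<M. f (M + n))" for f :: "nat \<Rightarrow> rat fps"
      by (rule prod.reindex_bij_witness[of _ "\<lambda>n. M + n" "\<lambda>n. n - M"]) auto
    ultimately show ?thesis
      by (simp add: prod.union_disjoint flip: power_mult)
  qed
  \<comment> \<open>This half leaves the exponents that are 3 modulo 4, in reverse order; the other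
    half leaves those that are 1 modulo 4. Together they are all odd numbers below 4M.\<close>
  also have "(\<Prod>n<M. ?X ^ (4 * M - 1) + ?X ^ (4 * n)) =
      (\<Prod>n<M. ?X ^ (4 * n) * (1 + ?X ^ (2 * (2 * (M - Suc n) + 1) + 1)))"
  proof (rule prod.cong[OF refl])
    fix n assume "n \<in> {..<M}"
    hence "4 * M - 1 = 4 * n + (2 * (2 * (M - Suc n) + 1) + 1)"
      by auto
    thus "?X ^ (4 * M - 1) + ?X ^ (4 * n) = ?X ^ (4 * n) * (1 + ?X ^ (2 * (2 * (M - Suc n) + 1) + 1))"
      unfolding distrib_left power_add[symmetric] by simp
  qed
  also have "\<dots> = (\<Prod>n<M. ?X ^ (4 * n)) * (\<Prod>n<M. 1 + ?X ^ (2 * (2 * (M - Suc n) + 1) + 1))"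
    by (rule prod.distrib)
  also have "(\<Prod>n<M. 1 + ?X ^ (2 * (2 * (M - Suc n) + 1) + 1)) = (\<Prod>n<M. 1 + ?X ^ (2 * (2 * n + 1) + 1))"
    by (rule prod.nat_diff_reindex)
  also have "(\<Prod>n<M. ?X ^ (4 * M - 1) + ?X ^ (4 * (M + n))) =
      (\<Prod>n<M. ?X ^ (4 * M - 1) * (1 + ?X ^ (2 * (2 * n) + 1)))"
  proof (rule prod.cong[OF refl])
    fix n assume "n \<in> {..<M}"
    hence "4 * (M + n) = (4 * M - 1) + (2 * (2 * n) + 1)"
      by auto
    thus "?X ^ (4 * M - 1) + ?X ^ (4 * (M + n)) = ?X ^ (4 * M - 1) * (1 + ?X ^ (2 * (2 * n) + 1))"
      unfolding distrib_left power_add[symmetric] by simp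
  qed
  also have "\<dots> = (?X ^ (4 * M - 1)) ^ M * (\<Prod>n<M. 1 + ?X ^ (2 * (2 * n) + 1))"
    by (simp add: prod.distrib)
  also have "(\<Prod>n<M. ?X ^ (4 * n)) = ?X ^ (\<Sum>n<M. 4 * n)"
    by (simp add: power_sum)
  also have "?X ^ (\<Sum>n<M. 4 * n) * (\<Prod>n<M. 1 + ?X ^ (2 * (2 * n + 1) + 1)) *
      ((?X ^ (4 * M - 1)) ^ M * (\<Prod>n<M. 1 + ?X ^ (2 * (2 * n) + 1))) =
      ?X ^ c * ((\<Prod>n<M. 1 + ?X ^ (2 * (2 * n) + 1)) * (\<Prod>n<M. 1 + ?X ^ (2 * (2 * n + 1) + 1)))"
    by (simp only: Xc mult_ac)
  also have "(\<Prod>n<M. 1 + ?X ^ (2 * (2 * n) + 1)) * (\<Prod>n<M. 1 + ?X ^ (2 * (2 * n + 1) + 1)) =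
      (\<Prod>n<2 * M. 1 + ?X ^ (2 * n + 1))"
    using prod_residue_classes[of "\<lambda>n. 1 + ?X ^ (2 * n + 1)" 2 M] by (simp add: numeral_2_eq_2)
  finally show ?thesis
    by simp
qed

lemma qpoch_double:
  "qpoch x (2 * N) = (\<Prod>n<N. 1 - x ^ (2 * n + 1)) * qpoch (x ^ 2) N"
  using prod_residue_classes[of "\<lambda>n. 1 - x ^ Suc n" 2 N]
  by (simp add: lessThan_Suc numeral_2_eq_2 qpoch_def mult_ac flip: power_mult power_Suc)

text \<open>Multiplying 1 + x^r by 1 - x^r for odd r gives 1 - x^(2r); the odd-even splitting
  \<open>qpoch_double\<close>, applied to x and to x^2, expresses the odd products by
  q-factorials.\<close>

lemma gauss_prod_finite:
  fixes x :: "'a :: comm_ring_1"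
  shows "(\<Prod>n<2 * M. 1 + x ^ (2 * n + 1)) * qpoch x (4 * M) * qpoch (x ^ 4) (2 * M) =
    qpoch (x ^ 2) (4 * M) * qpoch (x ^ 2) (2 * M)"
proof -
  have *: "(\<Prod>n<2 * M. 1 + x ^ (2 * n + 1)) * (\<Prod>n<2 * M. 1 - x ^ (2 * n + 1)) =
      (\<Prod>n<2 * M. 1 - (x ^ 2) ^ (2 * n + 1))"
    unfolding prod.distrib[symmetric] power_mult[symmetric] mult.commute[of 2 "2 * _ + 1"]
    unfolding power_mult by (simp add: algebra_simps power2_eq_square)
  have "qpoch x (4 * M) = (\<Prod>n<2 * M. 1 - x ^ (2 * n + 1)) * qpoch (x ^ 2) (2 * M)"
    using qpoch_double[of x "2 * M"] by simp
  moreover have "qpoch (x ^ 2) (4 * M) = (\<Prod>n<2 * M. 1 - (x ^ 2) ^ (2 * n + 1)) * qpoch (x ^ 4) (2 * M)"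
    using qpoch_double[of "x ^ 2" "2 * M"] by (simp flip: power_mult)
  ultimately show ?thesis
    unfolding *[symmetric] by (simp add: mult_ac)
qed

lemma filterlim_linear_at_top:
  fixes f :: "nat \<Rightarrow> nat"
  assumes "\<And>M. M \<le> f M + c"
  shows "filterlim f at_top sequentially"
  unfolding filterlim_at_top
proof
  fix Z
  show "eventually (\<lambda>M. Z \<le> f M) sequentially"
    using eventually_ge_at_top[of "Z + c"]
  proof eventually_elim
    case (elim M)
    thus ?case
      using assms[of M] by simp
  qed
qed

text \<open>The product over odd exponents tends to the Gauss series divided by \<phi>(q^4).
  Multiplied by the q-factorials of \<open>gauss_prod_finite\<close> it has a second limit,
  \<phi>(q^2)^2, and \<phi>(q^4) cancels.\<close>

theorem theta_gauss:
  "theta_fps gauss_exp UNIV * euler_phi fps_X = euler_phi (fps_X ^ 2) ^ 2"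
proof -
  let ?O = "\<lambda>M. \<Prod>n<2 * M. 1 + fps_X ^ (2 * n + 1) :: rat fps"
  let ?\<theta> = "theta_fps gauss_exp UNIV"
  have "(\<lambda>M. \<Sum>k\<in>{- int M..int M}. fps_X ^ gauss_exp k *
      qbinomial (fps_X ^ 4) (2 * M) (nat (int M + k)))
    \<longlonglongrightarrow> ?\<theta> * inverse (euler_phi (fps_X ^ 4))"
  proof (rule tendsto_theta_fps[OF finite_gauss_exp_le])
    fix k :: int
    show "eventually (\<lambda>M. k \<in> {- int M..int M}) sequentially"
      using eventually_ge_at_top[of "nat \<bar>k\<bar>"] by eventually_elim auto
    show "(\<lambda>M. qbinomial (fps_X ^ 4) (2 * M) (nat (int M + k)))
        \<longlonglongrightarrow> inverse (euler_phi (fps_X ^ 4))"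
      by (intro qbinomial_tendsto filterlim_linear_at_top[where c = "nat \<bar>k\<bar>"]) auto
  qed auto
  hence O: "?O \<longlonglongrightarrow> ?\<theta> * inverse (euler_phi (fps_X ^ 4))"
  proof (rule Lim_transform_eventually)
    show "eventually (\<lambda>M. (\<Sum>k\<in>{- int M..int M}. fps_X ^ gauss_exp k *
        qbinomial (fps_X ^ 4) (2 * M) (nat (int M + k))) = ?O M) sequentially"
      using eventually_ge_at_top[of 1] by (rule eventually_mono) (rule gauss_sum_finite)
  qed
  have lin: "filterlim (\<lambda>M::nat. 4 * M) at_top sequentially"
    "filterlim (\<lambda>M::nat. 2 * M) at_top sequentially"
    by (auto intro!: filterlim_linear_at_top[where c = 0])
  have q: "(\<lambda>M. qpoch (fps_X ^ r) (f M)) \<longlonglongrightarrow> euler_phi (fps_X ^ r)"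
    if "filterlim f at_top sequentially" "r \<ge> 1" for r f
    using filterlim_compose[OF qpoch_tendsto_euler_phi that(1)] that by simp
  have "(\<lambda>M. ?O M * qpoch (fps_X ^ 1) (4 * M) * qpoch (fps_X ^ 4) (2 * M))
      \<longlonglongrightarrow> ?\<theta> * inverse (euler_phi (fps_X ^ 4)) * euler_phi (fps_X ^ 1) * euler_phi (fps_X ^ 4)"
    by (intro tendsto_mult_fps O q lin) auto
  moreover have "(\<lambda>M. ?O M * qpoch (fps_X ^ 1) (4 * M) * qpoch (fps_X ^ 4) (2 * M))
      \<longlonglongrightarrow> euler_phi (fps_X ^ 2) * euler_phi (fps_X ^ 2)"
    unfolding power_one_right gauss_prod_finite by (intro tendsto_mult_fps q lin) auto
  ultimately have "?\<theta> * inverse (euler_phi (fps_X ^ 4)) * euler_phi (fps_X ^ 1) * euler_phi (fps_X ^ 4) =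
      euler_phi (fps_X ^ 2) * euler_phi (fps_X ^ 2)"
    by (rule LIMSEQ_unique)
  moreover have "inverse (euler_phi (fps_X ^ 4)) * euler_phi (fps_X ^ 4) = 1"
    by (rule inverse_mult_eq_1) simp
  ultimately show ?thesis
    by (simp add: mult_ac power2_eq_square)
qed

subsection \<open>The lattice sum\<close>

text \<open>Differences of the tuple \<open>k\<close> padded by \<open>k\<^sub>0 = k\<^sub>N = 0\<close>: the usual coordinates
  of zero sum on the root lattice \<open>A\<close> of rank \<open>N - 1\<close>.\<close>

definition pad :: "nat \<Rightarrow> (nat \<Rightarrow> int) \<Rightarrow> nat \<Rightarrow> int" where
  "pad N k i = (if 1 \<le> i \<and> i < N then k i else 0)"

definition step :: "nat \<Rightarrow> (nat \<Rightarrow> int) \<Rightarrow> nat \<Rightarrow> int" where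
  "step N k j = pad N k (Suc j) - pad N k j"

lemma pad_0 [simp]: "pad N k 0 = 0" and pad_self [simp]: "pad N k N = 0"
  by (auto simp: pad_def)

lemma sum_step: "(\<Sum>j<i. step N k j) = pad N k i"
  unfolding step_def by (subst sum_lessThan_telescope) simp

text \<open>Adding M to each difference makes it an exponent of y in a polynomial of degree at most
  2M, and zero sum becomes total degree N M. The lattice points thus index the terms of a middle
  coefficient; partial sums recover k.\<close>

lemma bij_betw_step:
  fixes N M :: nat
  defines "S \<equiv> {k \<in> {1..N - 1} \<rightarrow>\<^sub>E UNIV. \<forall>j<N. \<bar>step N k j\<bar> \<le> int M}"
  defines "T \<equiv> {f \<in> {..<N} \<rightarrow>\<^sub>E {..2 * M}. (\<Sum>j<N. f j) = N * M}"
  shows "bij_betw (\<lambda>k. \<lambda>j\<in>{..<N}. nat (int M + step N k j)) S T"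
proof (rule bij_betwI)
  let ?F = "\<lambda>k. \<lambda>j\<in>{..<N}. nat (int M + step N k j)"
  let ?G = "\<lambda>f. \<lambda>i\<in>{1..N - 1}. \<Sum>j<i. int (f j) - int M"
  have nonneg: "0 \<le> int M + step N k j" "step N k j \<le> int M" if "k \<in> S" "j < N" for k j
    using that by (force simp: S_def)+
  have step_G: "step N (?G f) j = int (f j) - int M" if f: "f \<in> T" and j: "j < N" for f j
  proof -
    \<comment> \<open>At \<open>i = N\<close> the constraint on the sum of \<open>f\<close> enters:
      it makes the full partial sum 0, the padded value.\<close>
    have "pad N (?G f) i = (\<Sum>j<i. int (f j) - int M)" if "i \<le> N" for i
    proof (cases "i = N")
      case True
      have "int (\<Sum>j<N. f j) = int (N * M)"
        using f by (simp add: T_def)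
      thus ?thesis
        using True by (simp add: sum_subtractf)
    next
      case False
      thus ?thesis
        using that by (cases "i = 0") (auto simp: pad_def)
    qed
    thus ?thesis
      using j by (simp add: step_def)
  qed
  show "?F \<in> S \<rightarrow> T"
  proof
    fix k assume k: "k \<in> S"
    have "int (\<Sum>j<N. ?F k j) = (\<Sum>j<N. int M + step N k j)"
      using nonneg[OF k] by (simp add: of_nat_sum)
    also have "\<dots> = int (N * M)"
      by (simp add: sum.distrib sum_step)
    finally have "(\<Sum>j<N. ?F k j) = N * M"
      by (simp only: of_nat_eq_iff)
    moreover have "?F k j \<le> 2 * M" if "j < N" for j
      using nonneg[OF k that] that by simp
    ultimately show "?F k \<in> T"
      by (simp add: T_def PiE_iff)
  qed
  show "?G \<in> T \<rightarrow> S"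
  proof
    fix f assume f: "f \<in> T"
    have "f j \<le> 2 * M" if "j < N" for j
      using f that by (auto simp: T_def PiE_iff)
    hence "\<bar>step N (?G f) j\<bar> \<le> int M" if "j < N" for j
      unfolding step_G[OF f that] using that by force
    thus "?G f \<in> S"
      by (simp add: S_def)
  qed
  show "?G (?F k) = k" if k: "k \<in> S" for k
  proof
    fix i
    show "?G (?F k) i = k i"
    proof (cases "i \<in> {1..N - 1}")
      case True
      hence "?G (?F k) i = (\<Sum>j<i. step N k j)"
        using nonneg[OF k] by (auto intro!: sum.cong)
      also have "\<dots> = k i"
        unfolding sum_step using True by (auto simp: pad_def)
      finally show ?thesis .
    next
      case False
      thus ?thesis
        using k by (auto simp: S_def PiE_iff extensional_def)
    qed
  qed
  show "?F (?G f) = f" if f: "f \<in> T" for f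
  proof
    fix j
    show "?F (?G f) j = f j"
      using f step_G[OF f] by (cases "j < N") (auto simp: T_def PiE_iff extensional_def)
  qed
qed

text \<open>Expanding the squared differences of the padded tuple, each square occurs twice and each
  neighbouring product once with factor -2.\<close>

lemma kappa_eq_sum_step: "2 * kappa l k = (\<Sum>j<Suc l. (step (Suc l) k j)\<^sup>2)"
proof -
  let ?K = "pad (Suc l) k"
  have 1: "(\<Sum>j<Suc l. (?K (Suc j))\<^sup>2) = (\<Sum>i=1..l. (k i)\<^sup>2)"
  proof -
    have "(\<Sum>j<Suc l. (?K (Suc j))\<^sup>2) = (\<Sum>j<l. (?K (Suc j))\<^sup>2)"
      by simp
    also have "\<dots> = (\<Sum>i=1..l. (k i)\<^sup>2)"
      by (rule sum.reindex_bij_witness[of _ "\<lambda>i. i - 1" Suc]) (auto simp: pad_def)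
    finally show ?thesis .
  qed
  have 2: "(\<Sum>j<Suc l. (?K j)\<^sup>2) = (\<Sum>i=1..l. (k i)\<^sup>2)"
  proof -
    have "(\<Sum>j<Suc l. (?K j)\<^sup>2) = (\<Sum>i=1..l. (?K i)\<^sup>2)"
      by (rule sum.mono_neutral_right) (auto simp: pad_def)
    thus ?thesis
      by (simp add: pad_def)
  qed
  have 3: "(\<Sum>j<Suc l. ?K j * ?K (Suc j)) = (\<Sum>i=1..<l. k i * k (i + 1))"
  proof -
    have "(\<Sum>j<Suc l. ?K j * ?K (Suc j)) = (\<Sum>i=1..<l. ?K i * ?K (Suc i))"
      by (rule sum.mono_neutral_right) (auto simp: pad_def)
    thus ?thesis
      by (simp add: pad_def)
  qed
  have "(\<Sum>j<Suc l. (step (Suc l) k j)\<^sup>2) =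
      (\<Sum>j<Suc l. (?K (Suc j))\<^sup>2) + (\<Sum>j<Suc l. (?K j)\<^sup>2) - 2 * (\<Sum>j<Suc l. ?K j * ?K (Suc j))"
    unfolding step_def sum_distrib_left sum.distrib[symmetric] sum_subtractf[symmetric]
    by (intro sum.cong) (auto simp: power2_eq_square algebra_simps)
  thus ?thesis
    unfolding 1 2 3 by (simp add: kappa_def)
qed

text \<open>Summing \<^const>\<open>lin_tilde\<close> by parts turns its coefficients into these weights: the residues
  \<open>2\<close> modulo 3 below \<open>3m\<close>, and all of \<open>0, \<dots>, 3m - 1\<close>.\<close>

definition weight :: "nat \<Rightarrow> nat \<Rightarrow> nat" where
  "weight m j = (if j < m then 3 * j + 2 else if j = 4 * m - 1 then 0 else j - m + 1)"

lemma weight_less: "j < 4 * m \<Longrightarrow> weight m j < 3 * m"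
  by (auto simp: weight_def)

lemma prod_lessThan_split:
  fixes g :: "nat \<Rightarrow> 'a :: comm_monoid_mult"
  assumes "n \<le> N"
  shows "prod g {..<N} = prod g {..<n} * prod g {n..<N}"
  using assms by (subst prod.union_disjoint[symmetric]) (auto simp: ivl_disj_un)

lemma bij_betw_weight:
  assumes "m \<ge> 1"
  shows "bij_betw (weight m) {m..<4 * m} {..<3 * m}"
  by (rule bij_betwI[where g = "\<lambda>a. if a = 0 then 4 * m - 1 else a + m - 1"])
    (use assms in \<open>auto simp: weight_def split: if_splits\<close>)

text \<open>By Abel summation \<open>k i\<close> gets the coefficient
  \<open>weight m (i - 1) - weight m i\<close>: slopes 3 and 1 give -3 and -1, the drop from 3m-1 to
  1 at \<open>i = m\<close> gives 3m-2, and the final drop from 3m-1 to 0 gives 3m-1.\<close>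

lemma lin_tilde_eq_sum_step:
  assumes m: "m \<ge> 1"
  shows "lin_tilde m k = (\<Sum>j<4 * m. int (weight m j) * step (4 * m) k j)"
proof -
  let ?K = "pad (4 * m) k"
  let ?g = "\<lambda>j. int (weight m j) * step (4 * m) k j"
  have 1: "(\<Sum>j<n. (3 * int j + 2) * (K (Suc j) - K j)) =
      (3 * int n - 1) * K n - 3 * (\<Sum>i=1..n - 1. K i)"
    if "n \<ge> 1" "K 0 = 0" for n and K :: "nat \<Rightarrow> int"
    using that(1)
  proof (induction n rule: nat_induct_at_least)
    case base
    show ?case
      using that by simp
  next
    case (Suc n)
    have "(\<Sum>i=1..Suc n - 1. K i) = (\<Sum>i=1..n - 1. K i) + K n"
      using Suc.hyps by (cases n) auto
    thus ?case
      using Suc.IH by (simp add: algebra_simps)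
  qed
  have 2: "(\<Sum>t<n. (int t + 1) * (K (Suc t) - K t)) = int n * K n - (\<Sum>t<n. K t)"
    for n and K :: "nat \<Rightarrow> int"
    by (induction n) (auto simp: algebra_simps)
  have "sum ?g {..<4 * m} = sum ?g {..<m} + sum ?g {m..<4 * m}"
    by (subst sum.union_disjoint[symmetric]) (auto simp: ivl_disj_un)
  also have "{m..<4 * m} = insert (4 * m - 1) {m..<4 * m - 1}"
    using m by auto
  also have "sum ?g \<dots> = sum ?g {m..<4 * m - 1}"
    by (simp add: weight_def)
  also have "sum ?g {..<m} = (\<Sum>j<m. (3 * int j + 2) * (?K (Suc j) - ?K j))"
    by (intro sum.cong) (auto simp: weight_def step_def)
  also have "\<dots> = (3 * int m - 1) * ?K m - 3 * (\<Sum>i=1..m - 1. ?K i)"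
    using m by (intro 1) auto
  also have "sum ?g {m..<4 * m - 1} = (\<Sum>t<3 * m - 1. (int t + 1) * (?K (m + Suc t) - ?K (m + t)))"
    by (rule sum.reindex_bij_witness[of _ "\<lambda>t. m + t" "\<lambda>j. j - m"])
      (auto simp: weight_def step_def)
  also have "\<dots> = int (3 * m - 1) * ?K (m + (3 * m - 1)) - (\<Sum>t<3 * m - 1. ?K (m + t))"
    by (rule 2)
  also have "(\<Sum>t<3 * m - 1. ?K (m + t)) = (\<Sum>i=m..4 * m - 2. ?K i)"
    by (rule sum.reindex_bij_witness[of _ "\<lambda>i. i - m" "\<lambda>t. m + t"]) (use m in auto)
  also have "\<dots> = ?K m + (\<Sum>i=m + 1..4 * m - 2. ?K i)"
    using m by (subst sum.atLeast_Suc_atMost) auto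
  also have "(\<Sum>i=m + 1..4 * m - 2. ?K i) = (\<Sum>i=m + 1..4 * m - 2. k i)"
    by (intro sum.cong) (auto simp: pad_def)
  also have "(\<Sum>i=1..m - 1. ?K i) = (\<Sum>i=1..m - 1. k i)"
    by (intro sum.cong) (auto simp: pad_def)
  also have "m + (3 * m - 1) = 4 * m - 1"
    using m by simp
  also have "?K (4 * m - 1) = k (4 * m - 1)" 
    using m by (simp add: pad_def)
  also have "?K m = k m"
    using m by (simp add: pad_def)
  finally show ?thesis
    using m by (simp add: lin_tilde_def algebra_simps of_nat_diff)
qed

section \<open>Theta form of the exponent, its lower bounds and the finiteness of its sublevel
  sets\<close>

definition lattice_exp :: "nat \<Rightarrow> (nat \<Rightarrow> int) \<Rightarrow> int" where
  "lattice_exp m k = 3 * int m * kappa (4 * m - 1) k + lin_tilde m k"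

text \<open>The differences sum to 0, so 3m times their sum may be subtracted freely. This turns x^2
  into x(x-1), the shape of \<open>choose 2\<close> in the q-binomial theorem; doubling avoids
  halves.\<close>

lemma lattice_exp_eq_sum_step:
  assumes "m \<ge> 1"
  shows "2 * lattice_exp m k = (\<Sum>j<4 * m. 3 * int m * (step (4 * m) k j * (step (4 * m) k j - 1))
           + 2 * int (weight m j) * step (4 * m) k j)"
proof -
  have "2 * lattice_exp m k = 3 * int m * (2 * kappa (4 * m - 1) k) + 2 * lin_tilde m k
      - 3 * int m * (\<Sum>j<4 * m. step (4 * m) k j)"
    by (simp add: lattice_exp_def sum_step)
  also have "2 * kappa (4 * m - 1) k = (\<Sum>j<4 * m. (step (4 * m) k j)\<^sup>2)"
    using kappa_eq_sum_step[of "4 * m - 1" k] assms by simp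
  also have "3 * int m * \<dots> + 2 * lin_tilde m k - 3 * int m * (\<Sum>j<4 * m. step (4 * m) k j) =
      (\<Sum>j<4 * m. 3 * int m * (step (4 * m) k j * (step (4 * m) k j - 1))
           + 2 * int (weight m j) * step (4 * m) k j)"
    unfolding lin_tilde_eq_sum_step[OF assms] sum_distrib_left sum.distrib[symmetric] sum_subtractf[symmetric]
    by (intro sum.cong refl) (simp add: algebra_simps power2_eq_square)
  finally show ?thesis .
qed

text \<open>Nonnegativity lets \<open>nat\<close> be applied to the exponent, and linear growth
  makes sublevel sets finite. The -1 in the bound is forced by x = 1, d = 0, where the right side is
  0.\<close>

lemma abs_le_theta_exponent:
  fixes x d m :: int
  assumes "0 \<le> d" "d < 3 * m"
  shows "2 * (\<bar>x\<bar> - 1) \<le> 3 * m * (x * (x - 1)) + 2 * d * x"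
    and "0 \<le> 3 * m * (x * (x - 1)) + 2 * d * x"
proof -
  have m: "m \<ge> 1"
    using assms by linarith
  consider "x \<ge> 1" | "x = 0" | "x \<le> -1"
    by linarith
  hence "2 * (\<bar>x\<bar> - 1) \<le> 3 * m * (x * (x - 1)) + 2 * d * x \<and> 0 \<le> 3 * m * (x * (x - 1)) + 2 * d * x"
  proof cases
    case 1
    have "3 * (1 * (x - 1)) \<le> 3 * m * (x * (x - 1))"
      unfolding mult.assoc[of 3] using 1 m by (intro mult_mono mult_nonneg_nonneg) (auto simp: mult_le_cancel_right1)
    moreover have "0 \<le> d * x"
      using 1 assms by simp
    ultimately show ?thesis
      using 1 by auto
  next
    case 3
    have "0 \<le> 3 * m * ((x + 1) * x)"
      using 3 m by (intro mult_nonneg_nonneg mult_nonpos_nonpos) auto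
    \<comment> \<open>Integrality of d < 3m gives 2d - 6m \<le> -2, and multiplying by the negative
      x reverses the inequality.\<close>
    moreover have "(2 * d - 6 * m) * x \<ge> (- 2) * x"
      using 3 assms by (intro mult_right_mono_neg) auto
    moreover have "3 * m * (x * (x - 1)) + 2 * d * x = 3 * m * ((x + 1) * x) + (2 * d - 6 * m) * x"
      by (simp add: algebra_simps)
    ultimately have "- 2 * x \<le> 3 * m * (x * (x - 1)) + 2 * d * x"
      by (metis add_increasing)
    thus ?thesis
      using 3 by auto
  qed auto
  thus "2 * (\<bar>x\<bar> - 1) \<le> 3 * m * (x * (x - 1)) + 2 * d * x"
    and "0 \<le> 3 * m * (x * (x - 1)) + 2 * d * x" by auto
qed

lemma lattice_exp_bounds:
  assumes "m \<ge> 1"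
  shows "0 \<le> lattice_exp m k"
    and "j < 4 * m \<Longrightarrow> \<bar>step (4 * m) k j\<bar> \<le> lattice_exp m k + 1"
proof -
  let ?t = "\<lambda>j. 3 * int m * (step (4 * m) k j * (step (4 * m) k j - 1))
           + 2 * int (weight m j) * step (4 * m) k j"
  note t = abs_le_theta_exponent[of "int (weight m j)" "int m" "step (4 * m) k j" for j]
  have nonneg: "0 \<le> ?t j" if "j < 4 * m" for j
    using t(2)[of j] weight_less[OF that] by simp
  thus "0 \<le> lattice_exp m k"
    using lattice_exp_eq_sum_step[OF assms, of k] sum_nonneg[of "{..<4 * m}" ?t] by simp
  assume j: "j < 4 * m"
  have "2 * (\<bar>step (4 * m) k j\<bar> - 1) \<le> ?t j"
    using t(1)[of j] weight_less[OF j] by simp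
  also have "\<dots> \<le> sum ?t {..<4 * m}"
    using nonneg j by (intro member_le_sum) auto
  also have "\<dots> = 2 * lattice_exp m k"
    using lattice_exp_eq_sum_step[OF assms] by simp
  finally show "\<bar>step (4 * m) k j\<bar> \<le> lattice_exp m k + 1"
    by simp
qed

text \<open>This exhausts the lattice by boxes in the difference coordinates, so that each box is
  exactly the index set of \<open>bij_betw_step\<close>.\<close>

definition lattice_box :: "nat \<Rightarrow> nat \<Rightarrow> (nat \<Rightarrow> int) set" where
  "lattice_box N M = {k \<in> {1..N - 1} \<rightarrow>\<^sub>E UNIV. \<forall>j<N. \<bar>step N k j\<bar> \<le> int M}"

lemma finite_lattice_box: "finite (lattice_box N M)"
proof -
  have "finite {f \<in> {..<N} \<rightarrow>\<^sub>E {..2 * M}. (\<Sum>j<N. f j) = N * M}"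
    by (rule finite_subset[of _ "{..<N} \<rightarrow>\<^sub>E {..2 * M}"]) (auto intro: finite_PiE)
  thus ?thesis
    using bij_betw_finite[OF bij_betw_step[where N = N and M = M]] by (simp add: lattice_box_def)
qed

lemma finite_lattice_exp_le:
  assumes "m \<ge> 1"
  shows "finite {k \<in> {1..4 * m - 1} \<rightarrow>\<^sub>E UNIV. nat (lattice_exp m k) \<le> n}"
proof (rule finite_subset[OF _ finite_lattice_box])
  show "{k \<in> {1..4 * m - 1} \<rightarrow>\<^sub>E UNIV. nat (lattice_exp m k) \<le> n} \<subseteq> lattice_box (4 * m) (n + 1)"
  proof
    fix k assume k: "k \<in> {k \<in> {1..4 * m - 1} \<rightarrow>\<^sub>E UNIV. nat (lattice_exp m k) \<le> n}"
    hence "\<bar>step (4 * m) k j\<bar> \<le> int (n + 1)" if "j < 4 * m" for j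
      using lattice_exp_bounds(2)[OF assms that, of k] by (simp add: nat_le_iff)
    thus "k \<in> lattice_box (4 * m) (n + 1)"
      using k unfolding lattice_box_def by blast
  qed
qed

section \<open>Finite form of the identity: one product in y, expanded in two ways\<close>

lemma coeff_prod_PiE:
  fixes p :: "'b \<Rightarrow> 'a :: comm_ring_1 poly"
  assumes "finite J" "\<And>j. j \<in> J \<Longrightarrow> degree (p j) \<le> D"
  shows "coeff (\<Prod>j\<in>J. p j) n = (\<Sum>f | f \<in> J \<rightarrow>\<^sub>E {..D} \<and> (\<Sum>j\<in>J. f j) = n. \<Prod>j\<in>J. coeff (p j) (f j))"
proof -
  have monom: "(\<Prod>j\<in>J. monom (c j) (f j)) = monom (\<Prod>j\<in>J. c j) (\<Sum>j\<in>J. f j)"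
    for c :: "'b \<Rightarrow> 'a" and f
    using assms(1) by (induction J) (auto simp: mult_monom)
  have "(\<Prod>j\<in>J. p j) = (\<Prod>j\<in>J. \<Sum>i\<le>D. monom (coeff (p j) i) i)"
    using assms(2) by (intro prod.cong) (auto simp: poly_as_sum_of_monoms')
  also have "\<dots> = (\<Sum>f\<in>J \<rightarrow>\<^sub>E {..D}. monom (\<Prod>j\<in>J. coeff (p j) (f j)) (\<Sum>j\<in>J. f j))"
    using assms(1) by (simp add: prod_sum_PiE monom)
  finally have "coeff (\<Prod>j\<in>J. p j) n =
      (\<Sum>f\<in>J \<rightarrow>\<^sub>E {..D}. if (\<Sum>j\<in>J. f j) = n then \<Prod>j\<in>J. coeff (p j) (f j) else 0)"
    by (simp add: coeff_sum)
  also have "\<dots> = (\<Sum>f | f \<in> J \<rightarrow>\<^sub>E {..D} \<and> (\<Sum>j\<in>J. f j) = n. \<Prod>j\<in>J. coeff (p j) (f j))"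
    by (rule sum.inter_filter[symmetric]) (simp add: assms(1) finite_PiE)
  finally show ?thesis .
qed

text \<open>For j < m the arguments are 2 + 3(j + m n), covering an initial stretch of the class 2
  modulo 3. For the other j the weights permute the residues modulo 3m, and the arguments fill an
  initial segment of the naturals.\<close>

lemma prod_theta_factors:
  fixes F :: "nat \<Rightarrow> 'a :: comm_monoid_mult"
  assumes "m \<ge> 1"
  shows "(\<Prod>j<4 * m. \<Prod>n<L. F (weight m j + 3 * m * n)) =
    (\<Prod>n<3 * m * L. F n) * (\<Prod>n<m * L. F (2 + 3 * n))"
proof -
  have "(\<Prod>j<m. \<Prod>n<L. F (weight m j + 3 * m * n)) = (\<Prod>j<m. \<Prod>n<L. F (2 + 3 * (j + m * n)))"
    by (intro prod.cong arg_cong[of _ _ F]) (auto simp: weight_def algebra_simps)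
  also have "\<dots> = (\<Prod>n<m * L. F (2 + 3 * n))"
    by (rule prod_residue_classes)
  finally have "(\<Prod>j<m. \<Prod>n<L. F (weight m j + 3 * m * n)) = (\<Prod>n<m * L. F (2 + 3 * n))" .
  moreover have "(\<Prod>j\<in>{m..<4 * m}. \<Prod>n<L. F (weight m j + 3 * m * n)) =
      (\<Prod>j<3 * m. \<Prod>n<L. F (j + 3 * m * n))"
    by (rule prod.reindex_bij_betw[OF bij_betw_weight[OF assms]])
  moreover have "(\<Prod>j<3 * m. \<Prod>n<L. F (j + 3 * m * n)) = (\<Prod>n<3 * m * L. F n)"
    by (rule prod_residue_classes)
  ultimately have "(\<Prod>j<m. \<Prod>n<L. F (weight m j + 3 * m * n)) *
      (\<Prod>j\<in>{m..<4 * m}. \<Prod>n<L. F (weight m j + 3 * m * n)) =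
      (\<Prod>n<m * L. F (2 + 3 * n)) * (\<Prod>n<3 * m * L. F n)"
    by (simp only:)
  thus ?thesis
    using prod_lessThan_split[of m "4 * m" "\<lambda>j. \<Prod>n<L. F (weight m j + 3 * m * n)"]
    by (simp add: mult.commute)
qed

lemma sum_weight: "m \<ge> 1 \<Longrightarrow> (\<Sum>j<4 * m. int (weight m j)) = 6 * int m ^ 2 - int m"
proof -
  assume m: "m \<ge> 1"
  have a: "2 * (\<Sum>j<n. int j) = int n * (int n - 1)" for n
    by (induction n) (auto simp: algebra_simps)
  have "(\<Sum>j<4 * m. int (weight m j)) = (\<Sum>j<m. int (weight m j)) + (\<Sum>j\<in>{m..<4 * m}. int (weight m j))"
    by (subst sum.union_disjoint[symmetric]) (auto simp: ivl_disj_un)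
  also have "(\<Sum>j<m. int (weight m j)) = 3 * (\<Sum>j<m. int j) + 2 * int m"
    by (simp add: weight_def sum.distrib sum_distrib_left)
  also have "(\<Sum>j\<in>{m..<4 * m}. int (weight m j)) = (\<Sum>j<3 * m. int j)"
    by (rule sum.reindex_bij_betw[OF bij_betw_weight[OF m]])
  finally show ?thesis
    using a[of m] a[of "3 * m"] by (simp add: algebra_simps power2_eq_square)
qed

text \<open>Both sides, times q^c, are the coefficient of y^(4mM) in the product of 1 + y q^(weight
  + 3mn) over j < 4m and n < 2M. Grouping by j gives the left side, regrouping by residue classes
  the right side.\<close>

lemma lattice_sum_finite:
  assumes m: "m \<ge> 1" and M: "M \<ge> 1"
  shows "(\<Sum>k\<in>lattice_box (4 * m) M. fps_X ^ nat (lattice_exp m k) *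
            (\<Prod>j<4 * m. qbinomial (fps_X ^ (3 * m)) (2 * M) (nat (int M + step (4 * m) k j)))) =
    (\<Sum>k\<in>{- int (3 * m * M)..int (m * M)}. fps_X ^ gauss_exp k *
            (qbinomial fps_X (6 * m * M) (nat (int (3 * m * M) + k)) *
             qbinomial (fps_X ^ 3) (2 * m * M) (nat (int (m * M) - k))) :: rat fps)"
proof -
  let ?X = "fps_X :: rat fps"
  \<comment> \<open>The exponent of the central term: all degrees equal to M on the left, k = 0 on
    the right.\<close>
  define c where "c = nat (6 * (int m * int M) ^ 2 - int m * int M)"
  have c: "int c = 6 * (int m * int M) ^ 2 - int m * int M"
  proof -
    have "1 * (int m * int M) \<le> (6 * (int m * int M)) * (int m * int M)"
    proof (intro mult_right_mono)
      have "1 \<le> m * M"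
        using m M by simp
      hence "1 \<le> int m * int M"
        by (simp flip: of_nat_mult)
      thus "1 \<le> 6 * (int m * int M)"
        by linarith
    qed simp
    thus ?thesis
      by (simp add: c_def power2_eq_square)
  qed
  let ?n = "4 * m * M"
  let ?p = "\<lambda>j. \<Prod>n<2 * M. [:1, ?X ^ weight m j * (?X ^ (3 * m)) ^ n:]"
  let ?qb = "\<lambda>i. qbinomial (?X ^ (3 * m)) (2 * M) i"
  have "coeff (\<Prod>j<4 * m. ?p j) ?n = (\<Sum>f | f \<in> {..<4 * m} \<rightarrow>\<^sub>E {..2 * M} \<and> (\<Sum>j<4 * m. f j) = ?n.
      \<Prod>j<4 * m. coeff (?p j) (f j))"
    by (rule coeff_prod_PiE) (auto intro: degree_qbinomial_prod_le)
  also have "\<dots> = (\<Sum>k\<in>lattice_box (4 * m) M. \<Prod>j<4 * m. coeff (?p j)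
      ((\<lambda>j\<in>{..<4 * m}. nat (int M + step (4 * m) k j)) j))"
    using sum.reindex_bij_betw[OF bij_betw_step[where N = "4 * m" and M = M],
        of "\<lambda>f. \<Prod>j<4 * m. coeff (?p j) (f j)"]
    unfolding lattice_box_def by simp
  also have "\<dots> = (\<Sum>k\<in>lattice_box (4 * m) M. ?X ^ c * (?X ^ nat (lattice_exp m k) *
            (\<Prod>j<4 * m. ?qb (nat (int M + step (4 * m) k j)))))"
  proof (rule sum.cong[OF refl])
    fix k assume k: "k \<in> lattice_box (4 * m) M"
    let ?s = "step (4 * m) k"
    define f where "f j = nat (int M + ?s j)" for j
    have f: "int (f j) = int M + ?s j" if "j < 4 * m" for j
      using k that by (force simp: lattice_box_def f_def)
    let ?e = "\<Sum>j<4 * m. 3 * m * (f j choose 2) + weight m j * f j"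
    have "2 * int ?e = (\<Sum>j<4 * m. 3 * int m * (2 * int (f j choose 2)) + 2 * int (weight m j) * int (f j))"
      by (simp add: sum_distrib_left algebra_simps)
    \<comment> \<open>Here f = M + s gives f(f-1) = s(s-1) + M(M-1) + 2Ms. The part 2Ms vanishes on
      summation because the differences telescope to 0, and the constants add up to 2c.\<close>
    also have "\<dots> = (\<Sum>j<4 * m. (3 * int m * (?s j * (?s j - 1)) + 2 * int (weight m j) * ?s j)
        + 3 * int m * (int M * (int M - 1)) + 6 * int m * int M * ?s j + 2 * int M * int (weight m j))"
      unfolding two_times_choose_two by (intro sum.cong) (simp_all add: f algebra_simps)
    also have "\<dots> = 2 * lattice_exp m k + 4 * int m * (3 * int m * (int M * (int M - 1)))
        + 6 * int m * int M * (\<Sum>j<4 * m. ?s j) + 2 * int M * (\<Sum>j<4 * m. int (weight m j))"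
      unfolding lattice_exp_eq_sum_step[OF m] by (simp add: sum.distrib sum_distrib_left)
    also have "\<dots> = 2 * int (c + nat (lattice_exp m k))"
      unfolding sum_weight[OF m] sum_step using lattice_exp_bounds(1)[OF m, of k]
      by (simp add: c algebra_simps power2_eq_square)
    finally have "int ?e = int (c + nat (lattice_exp m k))"
      by (simp only: mult_cancel_left) simp
    hence e: "?e = c + nat (lattice_exp m k)"
      by (simp only: of_nat_eq_iff)
    have "(\<Prod>j<4 * m. coeff (?p j) ((\<lambda>j\<in>{..<4 * m}. nat (int M + ?s j)) j)) =
        (\<Prod>j<4 * m. ?qb (f j) * ?X ^ (3 * m * (f j choose 2) + weight m j * f j))"
      by (intro prod.cong) (simp_all add: f_def qbinomial_theorem mult.assoc power_add power_mult)
    also have "\<dots> = ?X ^ ?e * (\<Prod>j<4 * m. ?qb (f j))"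
      by (simp add: prod.distrib power_sum)
    also have "\<dots> = ?X ^ c * (?X ^ nat (lattice_exp m k) * (\<Prod>j<4 * m. ?qb (f j)))"
      unfolding e by (simp only: power_add mult.assoc)
    finally show "(\<Prod>j<4 * m. coeff (?p j) ((\<lambda>j\<in>{..<4 * m}. nat (int M + ?s j)) j)) =
        ?X ^ c * (?X ^ nat (lattice_exp m k) * (\<Prod>j<4 * m. ?qb (nat (int M + ?s j))))"
      unfolding f_def .
  qed
  also have "\<dots> = ?X ^ c * (\<Sum>k\<in>lattice_box (4 * m) M. ?X ^ nat (lattice_exp m k) *
            (\<Prod>j<4 * m. ?qb (nat (int M + step (4 * m) k j))))"
    by (rule sum_distrib_left[symmetric])
  finally have lhs: "coeff (\<Prod>j<4 * m. ?p j) ?n = \<dots>" .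

  have "(\<Prod>j<4 * m. ?p j) = (\<Prod>j<4 * m. \<Prod>n<2 * M. [:1, ?X ^ (weight m j + 3 * m * n):])"
    by (simp add: power_add power_mult)
  \<comment> \<open>The 8mM factors regroup into a product in base q and one in base q^3 shifted by
    q^2, each subject to the q-binomial theorem.\<close>
  also have "\<dots> = (\<Prod>n<6 * m * M. [:1, 1 * ?X ^ n:]) * (\<Prod>n<2 * m * M. [:1, ?X ^ 2 * (?X ^ 3) ^ n:])"
  proof -
    have "3 * m * (2 * M) = 6 * m * M" "m * (2 * M) = 2 * m * M"
      by simp_all
    moreover have "?X ^ (2 + 3 * n) = ?X ^ 2 * (?X ^ 3) ^ n" for n
      by (simp only: power_add power_mult)
    ultimately show ?thesis
      using prod_theta_factors[OF m, of "\<lambda>n. [:1, ?X ^ n:]" "2 * M"] by (simp only: mult_1)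
  qed
  finally have "coeff (\<Prod>j<4 * m. ?p j) ?n = (\<Sum>i\<le>?n. qbinomial ?X (6 * m * M) i * ?X ^ (i choose 2) *
      (qbinomial (?X ^ 3) (2 * m * M) (?n - i) * (?X ^ 3) ^ ((?n - i) choose 2) * (?X ^ 2) ^ (?n - i)))"
    using qbinomial_theorem[of 1 1 ?X] by (simp add: coeff_mult qbinomial_theorem)
  also have "\<dots> = (\<Sum>k\<in>{- int (3 * m * M)..int (m * M)}. ?X ^ c * (?X ^ gauss_exp k *
            (qbinomial ?X (6 * m * M) (nat (int (3 * m * M) + k)) *
             qbinomial (?X ^ 3) (2 * m * M) (nat (int (m * M) - k)))))"
  \<comment> \<open>The degree splits as (3mM + k) + (mM - k), centring both binomials at half their
    length. The quadratic terms then combine to 2k^2 - k.\<close>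
  proof (rule sum.reindex_bij_witness[of _ "\<lambda>k. nat (int (3 * m * M) + k)" "\<lambda>i. int i - int (3 * m * M)"])
    fix i assume "i \<in> {..?n}"
    hence i: "i \<le> ?n"
      by simp
    let ?k = "int i - int (3 * m * M)"
    have i': "int (?n - i) = int m * int M - ?k"
      using i by (simp add: of_nat_diff)
    have "2 * int ((i choose 2) + 3 * (?n - i choose 2) + 2 * (?n - i)) =
        2 * int (i choose 2) + 3 * (2 * int (?n - i choose 2)) + 4 * int (?n - i)"
      by simp
    also have "\<dots> = 2 * int (c + gauss_exp ?k)"
      unfolding two_times_choose_two i' by (simp add: c algebra_simps power2_eq_square)
    finally have "int ((i choose 2) + 3 * (?n - i choose 2) + 2 * (?n - i)) = int (c + gauss_exp ?k)"
      by (simp only: mult_cancel_left) simp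
    hence "(i choose 2) + 3 * (?n - i choose 2) + 2 * (?n - i) = c + gauss_exp ?k"
      by (simp only: of_nat_eq_iff)
    hence pow: "?X ^ (i choose 2) * (?X ^ 3) ^ (?n - i choose 2) * (?X ^ 2) ^ (?n - i) = ?X ^ c * ?X ^ gauss_exp ?k"
      unfolding power_mult[symmetric] power_add[symmetric] by simp
    have i1: "nat (int (3 * m * M) + ?k) = i"
      by simp
    have "int (m * M) - ?k = int (?n - i)"
      using i' by simp
    hence i2: "nat (int (m * M) - ?k) = ?n - i"
      by (simp only: nat_int)
    show "?X ^ c * (?X ^ gauss_exp ?k * (qbinomial ?X (6 * m * M) (nat (int (3 * m * M) + ?k)) *
             qbinomial (?X ^ 3) (2 * m * M) (nat (int (m * M) - ?k)))) =
      qbinomial ?X (6 * m * M) i * ?X ^ (i choose 2) *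
      (qbinomial (?X ^ 3) (2 * m * M) (?n - i) * (?X ^ 3) ^ ((?n - i) choose 2) * (?X ^ 2) ^ (?n - i))"
      using arg_cong[OF pow, of "\<lambda>z. z * (qbinomial ?X (6 * m * M) i * qbinomial (?X ^ 3) (2 * m * M) (?n - i))"]
      unfolding i1 i2 by (simp only: mult_ac)
  qed (simp_all only: atMost_iff atLeastAtMost_iff mult.assoc, linarith+)
  also have "\<dots> = ?X ^ c * (\<Sum>k\<in>{- int (3 * m * M)..int (m * M)}. ?X ^ gauss_exp k *
            (qbinomial ?X (6 * m * M) (nat (int (3 * m * M) + k)) *
             qbinomial (?X ^ 3) (2 * m * M) (nat (int (m * M) - k))))"
    by (rule sum_distrib_left[symmetric])
  finally show ?thesis
    unfolding lhs by simp
qed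

section \<open>Passage to the limit and conclusion\<close>

text \<open>In the finite identity M tends to infinity. Every Gaussian binomial tends to 1/\<phi> of
  its base: 4m of them on the left, one in base q and one in base q^3 on the right.\<close>

lemma lattice_theta:
  assumes m: "m \<ge> 1"
  shows "theta_fps (\<lambda>k. nat (lattice_exp m k)) ({1..4 * m - 1} \<rightarrow>\<^sub>E UNIV) *
      inverse (euler_phi (fps_X ^ (3 * m))) ^ (4 * m) =
    theta_fps gauss_exp UNIV * (inverse (euler_phi fps_X) * inverse (euler_phi (fps_X ^ 3)))"
proof (rule LIMSEQ_unique)
  let ?A = "{1..4 * m - 1} \<rightarrow>\<^sub>E (UNIV :: int set)"
  let ?lhs = "\<lambda>M. \<Sum>k\<in>lattice_box (4 * m) M. fps_X ^ nat (lattice_exp m k) *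
            (\<Prod>j<4 * m. qbinomial (fps_X ^ (3 * m)) (2 * M) (nat (int M + step (4 * m) k j))) :: rat fps"
  let ?rhs = "\<lambda>M. \<Sum>k\<in>{- int (3 * m * M)..int (m * M)}. fps_X ^ gauss_exp k *
            (qbinomial fps_X (6 * m * M) (nat (int (3 * m * M) + k)) *
             qbinomial (fps_X ^ 3) (2 * m * M) (nat (int (m * M) - k))) :: rat fps"
  show lhs: "?lhs \<longlonglongrightarrow> theta_fps (\<lambda>k. nat (lattice_exp m k)) ?A *
      inverse (euler_phi (fps_X ^ (3 * m))) ^ (4 * m)"
  proof (rule tendsto_theta_fps[OF finite_lattice_exp_le[OF m] finite_lattice_box])
    fix k assume k: "k \<in> ?A"
    \<comment> \<open>A bound for all differences of \<open>k\<close>: from M = Z on the box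
      contains \<open>k\<close>, and both M + x and M - x are at least M - Z.\<close>
    define Z where "Z = Max (insert 0 ((\<lambda>j. nat \<bar>step (4 * m) k j\<bar>) ` {..<4 * m}))"
    have Z: "nat \<bar>step (4 * m) k j\<bar> \<le> Z" if "j < 4 * m" for j
      unfolding Z_def using that by (intro Max_ge) auto
    show "eventually (\<lambda>M. k \<in> lattice_box (4 * m) M) sequentially"
      using eventually_ge_at_top[of Z]
    proof eventually_elim
      case (elim M)
      have "\<bar>step (4 * m) k j\<bar> \<le> int M" if "j < 4 * m" for j
        using Z[OF that] elim by linarith
      thus ?case
        using k by (simp add: lattice_box_def)
    qed
    have "(\<lambda>M. \<Prod>j<4 * m. qbinomial (fps_X ^ (3 * m)) (2 * M) (nat (int M + step (4 * m) k j)))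
      \<longlonglongrightarrow> (\<Prod>j<4 * m. inverse (euler_phi (fps_X ^ (3 * m))))"
      by (intro tendsto_prod_finite_fps qbinomial_tendsto filterlim_linear_at_top[where c = Z])
        (use m Z in \<open>force simp: le_nat_iff\<close>)+
    thus "(\<lambda>M. \<Prod>j<4 * m. qbinomial (fps_X ^ (3 * m)) (2 * M) (nat (int M + step (4 * m) k j)))
      \<longlonglongrightarrow> inverse (euler_phi (fps_X ^ (3 * m))) ^ (4 * m)"
      by simp
  qed (auto simp: lattice_box_def)
  have rhs: "?rhs \<longlonglongrightarrow> theta_fps gauss_exp UNIV *
      (inverse (euler_phi fps_X) * inverse (euler_phi (fps_X ^ 3)))"
  proof (rule tendsto_theta_fps[OF finite_gauss_exp_le])
    fix k :: int
    have mM: "M \<le> m * M" for M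
      using m by simp
    show "eventually (\<lambda>M. k \<in> {- int (3 * m * M)..int (m * M)}) sequentially"
      using eventually_ge_at_top[of "nat \<bar>k\<bar>"]
    proof eventually_elim
      case (elim M)
      thus ?case
        using mM[of M] unfolding mult.assoc atLeastAtMost_iff by linarith
    qed
    \<comment> \<open>For each of the two binomials, the lower index and its complement grow at
      least like M - |k|.\<close>
    have "M \<le> nat (int (3 * m * M) + k) + nat \<bar>k\<bar>"
      "M \<le> 6 * m * M - nat (int (3 * m * M) + k) + nat \<bar>k\<bar>"
      "M \<le> nat (int (m * M) - k) + nat \<bar>k\<bar>"
      "M \<le> 2 * m * M - nat (int (m * M) - k) + nat \<bar>k\<bar>" for M
      using mM[of M] unfolding mult.assoc by linarith+
    note lim = this[THEN filterlim_linear_at_top]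
    have "(\<lambda>M. qbinomial (fps_X ^ 1) (6 * m * M) (nat (int (3 * m * M) + k)))
        \<longlonglongrightarrow> inverse (euler_phi (fps_X ^ 1))"
      by (intro qbinomial_tendsto lim) auto
    moreover have "(\<lambda>M. qbinomial (fps_X ^ 3) (2 * m * M) (nat (int (m * M) - k)))
        \<longlonglongrightarrow> inverse (euler_phi (fps_X ^ 3))"
      by (intro qbinomial_tendsto lim) auto
    ultimately show "(\<lambda>M. qbinomial fps_X (6 * m * M) (nat (int (3 * m * M) + k)) *
             qbinomial (fps_X ^ 3) (2 * m * M) (nat (int (m * M) - k)))
        \<longlonglongrightarrow> inverse (euler_phi fps_X) * inverse (euler_phi (fps_X ^ 3))"
      unfolding power_one_right by (rule tendsto_mult_fps)
  qed auto
  show "?lhs \<longlonglongrightarrow> theta_fps gauss_exp UNIV *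
      (inverse (euler_phi fps_X) * inverse (euler_phi (fps_X ^ 3)))"
  proof (rule Lim_transform_eventually[OF rhs])
    show "eventually (\<lambda>M. ?rhs M = ?lhs M) sequentially"
      using eventually_ge_at_top[of 1]
      by (rule eventually_mono) (rule lattice_sum_finite[OF m, symmetric])
  qed
qed

text \<open>The exponent is an integer whose sign is not evident from its form, hence
  \<open>powi\<close> in Laurent series. Extensional functions represent each tuple once, and
  \<open>has_sum\<close> expresses unordered q-adic summation.\<close>

theorem theorem7p1:
  fixes m :: nat
  assumes "m \<ge> 1"
  shows "((\<lambda>k. fls_X powi (3 * int m * kappa (4 * m - 1) k + lin_tilde m k)) has_sum
           fps_to_fls (euler_phi (fps_X ^ (3 * m)) ^ (4 * m) * euler_phi (fps_X ^ 2) ^ 2 /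
             (euler_phi fps_X ^ 2 * euler_phi (fps_X ^ 3))))
         ({1..4 * m - 1} \<rightarrow>\<^sub>E UNIV)"
proof -
  let ?A = "{1..4 * m - 1} \<rightarrow>\<^sub>E (UNIV :: int set)"
  let ?\<theta> = "theta_fps (\<lambda>k. nat (lattice_exp m k)) ?A" and ?G = "theta_fps gauss_exp UNIV"
  let ?\<phi> = "\<lambda>r. euler_phi (fps_X ^ r)"
  have inv: "inverse (?\<phi> r) * ?\<phi> r = 1" if "r \<ge> 1" for r
    using that by (intro inverse_mult_eq_1) simp
  \<comment> \<open>Of the two factors \<phi>(q), one cancels the inverse from
    \<open>lattice_theta\<close> and the other turns the Gauss series into \<phi>(q^2)^2.\<close>
  have "?\<theta> * (?\<phi> 1 ^ 2 * ?\<phi> 3) =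
      (?\<theta> * inverse (?\<phi> (3 * m)) ^ (4 * m)) * ?\<phi> (3 * m) ^ (4 * m) * (?\<phi> 1 ^ 2 * ?\<phi> 3)"
    using inv[of "3 * m"] assms by (simp add: mult.assoc flip: power_mult_distrib)
  also have "\<dots> = (inverse (?\<phi> 1) * ?\<phi> 1) * (inverse (?\<phi> 3) * ?\<phi> 3) * (?G * ?\<phi> 1) * ?\<phi> (3 * m) ^ (4 * m)"
    unfolding lattice_theta[OF assms] power_one_right power2_eq_square by (simp only: mult_ac)
  also have "\<dots> = ?\<phi> (3 * m) ^ (4 * m) * ?\<phi> 2 ^ 2"
    using theta_gauss inv[of 1] inv[of 3] by (simp add: mult.commute)
  finally have "?\<theta> * (euler_phi fps_X ^ 2 * ?\<phi> 3) = ?\<phi> (3 * m) ^ (4 * m) * ?\<phi> 2 ^ 2"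
    by simp
  hence \<theta>: "?\<theta> = ?\<phi> (3 * m) ^ (4 * m) * ?\<phi> 2 ^ 2 / (euler_phi fps_X ^ 2 * ?\<phi> 3)"
    using euler_phi_nonzero[of 1] euler_phi_nonzero[of 3]
    by (metis mult_eq_0_iff nonzero_mult_div_cancel_right one_le_numeral order_refl power_eq_0_iff power_one_right)
  have "((\<lambda>k. fps_to_fls (fps_X ^ nat (lattice_exp m k))) has_sum fps_to_fls ?\<theta>) ?A"
    using has_sum_theta_fps[OF finite_lattice_exp_le[OF assms]] by (rule has_sum_fps_to_fls)
  \<comment> \<open>Nonnegativity of the exponent makes the natural and the integer power
    agree.\<close>
  moreover have "fps_to_fls (fps_X ^ nat (lattice_exp m k)) =
      (fls_X powi (3 * int m * kappa (4 * m - 1) k + lin_tilde m k) :: rat fls)" for k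
    using lattice_exp_bounds(1)[OF assms, of k]
    by (simp add: fps_to_fls_power power_int_def lattice_exp_def)
  ultimately show ?thesis
    unfolding \<theta> by simp
qed

end
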